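(* Let $(x^*,z^* )\in\mathbb{Z}^n\times\mathbb{R}^m$ be the optimal solution of the linear program RIPD, and let $i\in I$ be such that $z_i^*\in\mathbb{R}\setminus\mathbb{Z}$. Then the Gomory cut which is violated by $(x^*,z^* )$ is the Forbidden Set Inequality $$\sum_{j\in S}x_j-\sum_{j\in N_i\setminus S}x_j\le |S|-1,$$ where $S:=\{j\in N_i : x_j^*=1\}$.
   Context: Let $H\in\{0,1\}^{m\times n}$ be a parity check matrix of a binary linear code $C=\{x\in\{0,1\}^n : Hx=0 \text{ in } GF(2)\}$. Write $I=\{1,\dots,m\}$, $J=\{1,\dots,n\}$, and $N_i=\{j\in J: H_{ij}=1\}$ for $i\in I$. Let $c\in\mathbb{R}^n$ be a cost vector. The linear program RIPD is $$\min c^Tx\quad\text{s.t.}\quad Hx-2z=0,\quad \Pi^Tx\le\Pi_0\ \text{ for all }(\Pi,\Pi_0)\in\Lambda,\quad 0\le x\le 1,\quad z\ge 0,$$ with variables $x\in\mathbb{R}^n$, $z\in\mathbb{R}^m$ ($Hx$ is computed over $\mathbb{R}$), where $\Lambda$ is the (initially empty) family of valid cuts added iteratively so far. It is the linear programming relaxation, with added cuts, of the integer program $\min\{c^Tx : Hx-2z=0,\ x\in\{0,1\}^n,\ z\ge 0 \text{ integer}\}$, which is maximum likelihood decoding. Forbidden Set Inequalities of row $i$ are the inequalities $\sum_{j\in S}x_j-\sum_{j\in N_i\setminus S}x_j\le|S|-1$ for $S\subseteq N_i$ with $|S|$ odd. Gomory cuts are the standard cuts of integer programming derived from the rows of the simplex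 tableau in order to cut off a non-integral LP solution: if the LP is written in standard form $Py=q$, $y\ge 0$ (with slack variables added), $P=[P_B\ P_N]$ is the partition into basis and non-basis columns at the optimal solution, and $N$ is the index set of the non-basic variables, then the Gomory cut for row $i$ is $\sum_{h\in N}(\bar p_{ih}-\lfloor\bar p_{ih}\rfloor)y_h\ge\bar q_i-\lfloor\bar q_i\rfloor$, where $\bar p_{ih}$ is the product of the $i$-th row of $P_B^{-1}$ with the column of $P_N$ belonging to $y_h$, and $\bar q_i$ is the product of the $i$-th row of $P_B^{-1}$ with $q$. Here the row concerned is the one belonging to $z_i$.
   Formalization: The Gomory cut is shown to be the Forbidden Set Inequality for bases in which, for each j in N_i, x_j or the slack of x_j ≤ 1 is non-basic (automatic for nondegenerate bases; one always exists); for other, degenerate bases the claim can fail. *)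

theory Defs
  imports "HOL-Analysis.Analysis" "HOL-Library.Z2"
begin

text \<open>
  The parity check matrix lives over \<open>GF(2)\<close>, i.e. the type \<^typ>\<open>bit\<close>; the code length and the
  number of checks are the cardinalities of the index types \<open>'n\<close> and \<open>'m\<close>.
\<close>

definition code :: "bit^'n^'m \<Rightarrow> (bit^'n) set" where
  "code H = {w. H *v w = 0}"

definition nbrs :: "bit^'n^'m \<Rightarrow> 'm \<Rightarrow> 'n set" where
  "nbrs H i = {j. H $ i $ j = 1}"

definition real_vec :: "bit^'n \<Rightarrow> real^'n" where
  "real_vec w = (\<chi> j. if w $ j = 1 then 1 else 0)"

definition real_mat :: "bit^'n^'m \<Rightarrow> real^'n^'m" where
  "real_mat H = (\<chi> i. real_vec (H $ i))"

subsection \<open>The linear program RIPD\<close>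

text \<open>A pair \<open>(\<Pi>, \<Pi>\<^sub>0)\<close> stands for the inequality \<open>\<Pi>\<^sup>T x \<le> \<Pi>\<^sub>0\<close>.\<close>

type_synonym 'n cut = "(real^'n) \<times> real"

definition valid_cut :: "bit^'n^'m \<Rightarrow> 'n cut \<Rightarrow> bool" where
  "valid_cut H p \<longleftrightarrow> (\<forall>w\<in>code H. fst p \<bullet> real_vec w \<le> snd p)"

definition RIPD_feasible :: "bit^'n^'m \<Rightarrow> 'n cut set \<Rightarrow> real^'n \<Rightarrow> real^'m \<Rightarrow> bool" where
  "RIPD_feasible H \<Lambda> x z \<longleftrightarrow>
     real_mat H *v x - 2 *\<^sub>R z = 0 \<and>
     (\<forall>p\<in>\<Lambda>. fst p \<bullet> x \<le> snd p) \<and>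
     (\<forall>j. 0 \<le> x $ j \<and> x $ j \<le> 1) \<and>
     (\<forall>i. 0 \<le> z $ i)"

definition RIPD_optimal ::
  "bit^'n^'m \<Rightarrow> real^'n \<Rightarrow> 'n cut set \<Rightarrow> real^'n \<Rightarrow> real^'m \<Rightarrow> bool" where
  "RIPD_optimal H c \<Lambda> x z \<longleftrightarrow>
     RIPD_feasible H \<Lambda> x z \<and> (\<forall>x' z'. RIPD_feasible H \<Lambda> x' z' \<longrightarrow> c \<bullet> x \<le> c \<bullet> x')"

subsection \<open>Forbidden Set Inequalities\<close>

definition forbidden_set :: "bit^'n^'m \<Rightarrow> 'm \<Rightarrow> 'n set \<Rightarrow> bool" where
  "forbidden_set H i S \<longleftrightarrow> S \<subseteq> nbrs H i \<and> odd (card S)"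

definition forbidden_set_ineq :: "bit^'n^'m \<Rightarrow> 'm \<Rightarrow> 'n set \<Rightarrow> real^'n \<Rightarrow> bool" where
  "forbidden_set_ineq H i S x \<longleftrightarrow>
     (\<Sum>j\<in>S. x $ j) - (\<Sum>j\<in>nbrs H i - S. x $ j) \<le> real (card S) - 1"

subsection \<open>Standard form \<open>P y = q\<close>, \<open>y \<ge> 0\<close>\<close>

text \<open>
  The number of rows and columns depends on \<open>\<Lambda>\<close>, so matrices are functions on explicit finite
  index sets. \<open>Slack p\<close> is the slack variable of the cut \<open>p\<close>, and \<open>Upper j\<close> that of \<open>x\<^sub>j \<le> 1\<close>.
\<close>

datatype ('n, 'm) lp_var = X 'n | Z 'm | Slack "'n cut" | Upper 'n

datatype ('n, 'm) lp_row = Check_row 'm | Cut_row "'n cut" | Upper_row 'n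

definition lp_vars :: "('n::finite) cut set \<Rightarrow> ('n, 'm) lp_var set" where
  "lp_vars \<Lambda> = range X \<union> range Z \<union> Slack ` \<Lambda> \<union> range Upper"

definition lp_rows :: "('n::finite) cut set \<Rightarrow> ('n, 'm) lp_row set" where
  "lp_rows \<Lambda> = range Check_row \<union> Cut_row ` \<Lambda> \<union> range Upper_row"

fun lp_mat :: "bit^'n^'m \<Rightarrow> ('n, 'm) lp_row \<Rightarrow> ('n, 'm) lp_var \<Rightarrow> real" where
  "lp_mat H (Check_row i) (X j) = real_mat H $ i $ j"
| "lp_mat H (Check_row i) (Z k) = (if k = i then - 2 else 0)"
| "lp_mat H (Cut_row p) (X j) = fst p $ j"
| "lp_mat H (Cut_row p) (Slack p') = (if p' = p then 1 else 0)"
| "lp_mat H (Upper_row j) (X k) = (if k = j then 1 else 0)"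
| "lp_mat H (Upper_row j) (Upper k) = (if k = j then 1 else 0)"
| "lp_mat H _ _ = 0"

fun lp_rhs :: "('n, 'm) lp_row \<Rightarrow> real" where
  "lp_rhs (Check_row i) = 0"
| "lp_rhs (Cut_row p) = snd p"
| "lp_rhs (Upper_row j) = 1"

fun lp_cost :: "real^'n \<Rightarrow> ('n, 'm) lp_var \<Rightarrow> real" where
  "lp_cost c (X j) = c $ j"
| "lp_cost c _ = 0"

definition lp_equations :: "bit^'n^'m \<Rightarrow> 'n cut set \<Rightarrow> (('n, 'm) lp_var \<Rightarrow> real) \<Rightarrow> bool" where
  "lp_equations H \<Lambda> y \<longleftrightarrow> (\<forall>r\<in>lp_rows \<Lambda>. (\<Sum>v\<in>lp_vars \<Lambda>. lp_mat H r v * y v) = lp_rhs r)"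

fun lp_point :: "real^'n \<Rightarrow> real^'m \<Rightarrow> ('n, 'm) lp_var \<Rightarrow> real" where
  "lp_point x z (X j) = x $ j"
| "lp_point x z (Z i) = z $ i"
| "lp_point x z (Slack p) = snd p - fst p \<bullet> x"
| "lp_point x z (Upper j) = 1 - x $ j"

definition x_part :: "(('n, 'm) lp_var \<Rightarrow> real) \<Rightarrow> real^'n" where
  "x_part y = (\<chi> j. y (X j))"

subsection \<open>Bases, tableaux and Gomory cuts\<close>

text \<open>
  \<open>Q\<close> is the inverse of the matrix \<open>P\<^sub>B\<close> formed by the columns in \<open>B\<close>; its rows are indexed by the
  basic variables.
\<close>

definition basis_inverse ::
  "bit^'n^'m \<Rightarrow> 'n cut set \<Rightarrow> ('n, 'm) lp_var set \<Rightarrow>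
   (('n, 'm) lp_var \<Rightarrow> ('n, 'm) lp_row \<Rightarrow> real) \<Rightarrow> bool" where
  "basis_inverse H \<Lambda> B Q \<longleftrightarrow>
     B \<subseteq> lp_vars \<Lambda> \<and>
     (\<forall>v\<in>B. \<forall>w\<in>B. (\<Sum>r\<in>lp_rows \<Lambda>. Q v r * lp_mat H r w) = (if v = w then 1 else 0)) \<and>
     (\<forall>r\<in>lp_rows \<Lambda>. \<forall>s\<in>lp_rows \<Lambda>. (\<Sum>v\<in>B. lp_mat H r v * Q v s) = (if r = s then 1 else 0))"

text \<open>
  The basic solution of \<open>B\<close> is the unique solution of \<open>P y = q\<close> whose non-basic variables vanish, so
  this says that \<open>(x, z)\<close>, completed by its slacks, is the basic solution of \<open>B\<close>.
\<close>

definition basis_at ::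
  "bit^'n^'m \<Rightarrow> 'n cut set \<Rightarrow> real^'n \<Rightarrow> real^'m \<Rightarrow> ('n, 'm) lp_var set \<Rightarrow>
   (('n, 'm) lp_var \<Rightarrow> ('n, 'm) lp_row \<Rightarrow> real) \<Rightarrow> bool" where
  "basis_at H \<Lambda> x z B Q \<longleftrightarrow>
     basis_inverse H \<Lambda> B Q \<and>
     lp_equations H \<Lambda> (lp_point x z) \<and>
     (\<forall>h\<in>lp_vars \<Lambda> - B. lp_point x z h = 0)"

definition tableau ::
  "bit^'n^'m \<Rightarrow> 'n cut set \<Rightarrow> (('n, 'm) lp_var \<Rightarrow> ('n, 'm) lp_row \<Rightarrow> real) \<Rightarrow>
   ('n, 'm) lp_var \<Rightarrow> ('n, 'm) lp_var \<Rightarrow> real" where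
  "tableau H \<Lambda> Q v h = (\<Sum>r\<in>lp_rows \<Lambda>. Q v r * lp_mat H r h)"

definition tableau_rhs ::
  "('n::finite) cut set \<Rightarrow> (('n, 'm) lp_var \<Rightarrow> ('n, 'm) lp_row \<Rightarrow> real) \<Rightarrow> ('n, 'm) lp_var \<Rightarrow> real" where
  "tableau_rhs \<Lambda> Q v = (\<Sum>r\<in>lp_rows \<Lambda>. Q v r * lp_rhs r)"

definition gomory_cut ::
  "bit^'n^'m \<Rightarrow> 'n cut set \<Rightarrow> ('n, 'm) lp_var set \<Rightarrow>
   (('n, 'm) lp_var \<Rightarrow> ('n, 'm) lp_row \<Rightarrow> real) \<Rightarrow> ('n, 'm) lp_var \<Rightarrow>
   (('n, 'm) lp_var \<Rightarrow> real) \<Rightarrow> bool" where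
  "gomory_cut H \<Lambda> B Q v y \<longleftrightarrow>
     (\<Sum>h\<in>lp_vars \<Lambda> - B. (tableau H \<Lambda> Q v h - of_int \<lfloor>tableau H \<Lambda> Q v h\<rfloor>) * y h)
       \<ge> tableau_rhs \<Lambda> Q v - of_int \<lfloor>tableau_rhs \<Lambda> Q v\<rfloor>"

definition nonneg_reduced_costs ::
  "bit^'n^'m \<Rightarrow> real^'n \<Rightarrow> 'n cut set \<Rightarrow> ('n, 'm) lp_var set \<Rightarrow>
   (('n, 'm) lp_var \<Rightarrow> ('n, 'm) lp_row \<Rightarrow> real) \<Rightarrow> bool" where
  "nonneg_reduced_costs H c \<Lambda> B Q \<longleftrightarrow>
     (\<forall>h\<in>lp_vars \<Lambda> - B. lp_cost c h - (\<Sum>v\<in>B. lp_cost c v * tableau H \<Lambda> Q v h) \<ge> 0)"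

text \<open>
  At a degenerate vertex the basis is not unique and the Gomory cut depends on its choice. The
  following describes bases in which every \<open>x\<^sub>j\<close> with \<open>j \<in> N\<^sub>i\<close> is non-basic at one of its bounds
  \<open>0\<close>, \<open>1\<close>. If \<open>x\<close> is binary, this holds for every nondegenerate basis at \<open>(x, z)\<close>, since one of
  \<open>X j\<close>, \<open>Upper j\<close> then has the value \<open>0\<close> and so is non-basic.
\<close>

definition nonbasic_at_bounds :: "bit^'n^'m \<Rightarrow> 'm \<Rightarrow> ('n, 'm) lp_var set \<Rightarrow> bool" where
  "nonbasic_at_bounds H i B \<longleftrightarrow> (\<forall>j\<in>nbrs H i. X j \<notin> B \<or> Upper j \<notin> B)"

end

theory Submission
  imports Defs
begin

text \<open>
  The row of \<open>P\<^sub>B\<^sup>-\<^sup>1\<close> belonging to \<open>z\<^sub>i\<close> is determined by its products with the basic columns.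
  If each \<open>x\<^sub>j\<close>, \<open>j \<in> N\<^sub>i\<close>, is non-basic at a bound, it is \<open>-1/2\<close> times check row \<open>i\<close> plus \<open>1/2\<close>
  times the rows \<open>x\<^sub>j \<le> 1\<close> with \<open>j \<in> S\<close>. So the tableau row has entries \<open>-1/2\<close> at \<open>x\<^sub>j\<close>,
  \<open>j \<in> N\<^sub>i - S\<close>, and \<open>1/2\<close> at the slack of \<open>x\<^sub>j \<le> 1\<close>, \<open>j \<in> S\<close>; as \<open>z\<^sub>i\<close> has fractional part
  \<open>1/2\<close>, the Gomory cut reads \<open>\<Sum>\<^bsub>N\<^sub>i - S\<^esub> x\<^sub>j + \<Sum>\<^bsub>S\<^esub> (1 - x\<^sub>j) \<ge> 1\<close>. A basis of this kind always
  exists at a binary point, and it is dual feasible when no cut is tight, since then each single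
  \<open>x\<^sub>j\<close> can be moved off its bound without leaving the feasible region.
\<close>

section \<open>Entries of the real check matrix and sums over the index sets\<close>

lemma real_mat_entry: "real_mat H $ i $ j = (if j \<in> nbrs H i then 1 else 0)"
  by (simp add: real_mat_def real_vec_def nbrs_def)

lemma real_mat_vec: "(real_mat H *v x) $ i = (\<Sum>j\<in>nbrs H i. x $ j)"
  by (simp add: matrix_vector_mult_def real_mat_entry if_distrib[of "\<lambda>a. a * _"] sum.If_cases
      cong: if_cong)

text \<open>Sums over a matrix column arise with the test \<open>k = i\<close> innermost;
  \<open>sum.delta\<close> expects it outermost.\<close>

lemma sum_if_delta:
  fixes i :: "'a::finite"
  shows "(\<Sum>k\<in>UNIV. if P k then if k = i then a k else 0 else 0) = (if P i then a i else 0)"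
proof -
  have "(if P k then if k = i then a k else 0 else 0) = (if k = i then if P k then a k else 0 else 0)"
    for k
    by simp
  then show ?thesis
    by (simp only: sum.delta finite UNIV_I if_True)
qed

lemma finite_lp_vars:
  "finite \<Lambda> \<Longrightarrow> finite (lp_vars \<Lambda> :: ('n::finite, 'm::finite) lp_var set)"
  by (simp add: lp_vars_def)

lemma finite_lp_rows:
  "finite \<Lambda> \<Longrightarrow> finite (lp_rows \<Lambda> :: ('n::finite, 'm::finite) lp_row set)"
  by (simp add: lp_rows_def)

lemma sum_lp_vars:
  fixes f :: "('n::finite, 'm::finite) lp_var \<Rightarrow> real"
  assumes "finite \<Lambda>"
  shows "(\<Sum>v\<in>lp_vars \<Lambda>. f v) =
    (\<Sum>j\<in>UNIV. f (X j)) + (\<Sum>i\<in>UNIV. f (Z i)) + (\<Sum>p\<in>\<Lambda>. f (Slack p)) + (\<Sum>j\<in>UNIV. f (Upper j))"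
proof -
  have "(\<Sum>v\<in>lp_vars \<Lambda>. f v) =
    sum f (range X) + sum f (range Z) + sum f (Slack ` \<Lambda>) + sum f (range Upper)"
    unfolding lp_vars_def using assms
    by (subst sum.union_disjoint; (auto)[1])+
  then show ?thesis
    by (simp add: sum.reindex inj_on_def)
qed

lemma sum_lp_rows:
  fixes f :: "('n::finite, 'm::finite) lp_row \<Rightarrow> real"
  assumes "finite \<Lambda>"
  shows "(\<Sum>r\<in>lp_rows \<Lambda>. f r) =
    (\<Sum>i\<in>UNIV. f (Check_row i)) + (\<Sum>p\<in>\<Lambda>. f (Cut_row p)) + (\<Sum>j\<in>UNIV. f (Upper_row j))"
proof -
  have "(\<Sum>r\<in>lp_rows \<Lambda>. f r) =
    sum f (range Check_row) + sum f (Cut_row ` \<Lambda>) + sum f (range Upper_row)"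
    unfolding lp_rows_def using assms
    by (subst sum.union_disjoint; (auto)[1])+
  then show ?thesis
    by (simp add: sum.reindex inj_on_def)
qed

lemma lp_vars_cases:
  assumes "v \<in> lp_vars \<Lambda>"
  obtains j where "v = X j" | i where "v = Z i" | p where "v = Slack p" "p \<in> \<Lambda>"
    | j where "v = Upper j"
  using assms by (auto simp: lp_vars_def)

lemma lp_rows_cases:
  assumes "r \<in> lp_rows \<Lambda>"
  obtains i where "r = Check_row i" | p where "r = Cut_row p" "p \<in> \<Lambda>"
    | j where "r = Upper_row j"
  using assms by (auto simp: lp_rows_def)

section \<open>Rows of P y and products of a row vector with the columns of P\<close>

lemma lp_row_Check:
  fixes H :: "bit^'n^'m"
  assumes "finite \<Lambda>"
  shows "(\<Sum>v\<in>lp_vars \<Lambda>. lp_mat H (Check_row i) v * y v) = (\<Sum>j\<in>nbrs H i. y (X j)) - 2 * y (Z i)"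
  by (simp add: sum_lp_vars[OF assms] real_mat_entry if_distrib[of "\<lambda>a. a * _"] sum.If_cases
      cong: if_cong)

lemma lp_row_Cut:
  fixes H :: "bit^'n^'m"
  assumes "finite \<Lambda>" "p \<in> \<Lambda>"
  shows "(\<Sum>v\<in>lp_vars \<Lambda>. lp_mat H (Cut_row p) v * y v) = (\<Sum>j\<in>UNIV. fst p $ j * y (X j)) + y (Slack p)"
  using assms(2)
  by (simp add: sum_lp_vars[OF assms(1)] if_distrib[of "\<lambda>a. a * _"] assms(1) cong: if_cong)

lemma lp_row_Upper:
  fixes H :: "bit^'n^'m"
  assumes "finite \<Lambda>"
  shows "(\<Sum>v\<in>lp_vars \<Lambda>. lp_mat H (Upper_row j) v * y v) = y (X j) + y (Upper j)"
  by (simp add: sum_lp_vars[OF assms] if_distrib[of "\<lambda>a. a * _"] cong: if_cong)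

lemma lp_col_X:
  fixes H :: "bit^'n^'m"
  assumes "finite \<Lambda>"
  shows "(\<Sum>r\<in>lp_rows \<Lambda>. g r * lp_mat H r (X j)) =
    (\<Sum>k\<in>UNIV. if j \<in> nbrs H k then g (Check_row k) else 0)
    + (\<Sum>p\<in>\<Lambda>. g (Cut_row p) * fst p $ j) + g (Upper_row j)"
  by (simp add: sum_lp_rows[OF assms] real_mat_entry if_distrib[of "\<lambda>a. _ * a"] cong: if_cong)

lemma lp_col_Z:
  fixes H :: "bit^'n^'m"
  assumes "finite \<Lambda>"
  shows "(\<Sum>r\<in>lp_rows \<Lambda>. g r * lp_mat H r (Z i)) = - 2 * g (Check_row i)"
  by (simp add: sum_lp_rows[OF assms] if_distrib[of "\<lambda>a. _ * a"] cong: if_cong)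

lemma lp_col_Slack:
  fixes H :: "bit^'n^'m"
  assumes "finite \<Lambda>" "p \<in> \<Lambda>"
  shows "(\<Sum>r\<in>lp_rows \<Lambda>. g r * lp_mat H r (Slack p)) = g (Cut_row p)"
  using assms(2)
  by (simp add: sum_lp_rows[OF assms(1)] if_distrib[of "\<lambda>a. _ * a"] assms(1) cong: if_cong)

lemma lp_col_Upper:
  fixes H :: "bit^'n^'m"
  assumes "finite \<Lambda>"
  shows "(\<Sum>r\<in>lp_rows \<Lambda>. g r * lp_mat H r (Upper j)) = g (Upper_row j)"
  by (simp add: sum_lp_rows[OF assms] if_distrib[of "\<lambda>a. _ * a"] cong: if_cong)

section \<open>Solutions of P y = q and inverses of basis matrices\<close>

lemma lp_equations_lp_point:
  fixes H :: "bit^'n^'m"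
  assumes "finite \<Lambda>" "RIPD_feasible H \<Lambda> x z"
  shows "lp_equations H \<Lambda> (lp_point x z)"
proof -
  have "(real_mat H *v x - 2 *\<^sub>R z) $ i = 0" for i
    using assms(2) by (simp add: RIPD_feasible_def)
  then have "(\<Sum>j\<in>nbrs H i. x $ j) = 2 * z $ i" for i
    by (simp add: real_mat_vec)
  then show ?thesis
    unfolding lp_equations_def
    by (auto elim!: lp_rows_cases
        simp: lp_row_Check lp_row_Cut lp_row_Upper assms(1) inner_vec_def)
qed

text \<open>If u P_B is the unit vector of \<open>v\<close>, multiplying by \<open>Q\<close> from
  the right gives u = u P_B Q, which is row \<open>v\<close> of \<open>Q\<close>. So a row of an
  abstract inverse can be identified by guessing it and testing it on the basic columns.\<close>

lemma basis_inverse_row_unique: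
  fixes H :: "bit^'n^'m"
  assumes "finite \<Lambda>" "basis_inverse H \<Lambda> B Q" "v \<in> B" "s \<in> lp_rows \<Lambda>"
    and u: "\<And>w. w \<in> B \<Longrightarrow> (\<Sum>r\<in>lp_rows \<Lambda>. u r * lp_mat H r w) = (if v = w then 1 else 0)"
  shows "Q v s = u s"
proof -
  have B: "finite B"
    using assms(2) finite_lp_vars[OF assms(1)]
    unfolding basis_inverse_def by (metis finite_subset)
  have "u s = (\<Sum>r\<in>lp_rows \<Lambda>. u r * (if r = s then 1 else 0))"
    using assms(4) by (simp add: finite_lp_rows[OF assms(1)] if_distrib[of "\<lambda>a. _ * a"] cong: if_cong)
  also have "\<dots> = (\<Sum>r\<in>lp_rows \<Lambda>. u r * (\<Sum>w\<in>B. lp_mat H r w * Q w s))"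
    using assms(2,4) by (intro sum.cong refl) (simp add: basis_inverse_def)
  also have "\<dots> = (\<Sum>w\<in>B. (\<Sum>r\<in>lp_rows \<Lambda>. u r * lp_mat H r w) * Q w s)"
    unfolding sum_distrib_left sum_distrib_right by (subst sum.swap) (simp add: mult.assoc)
  also have "\<dots> = (\<Sum>w\<in>B. if v = w then Q w s else 0)"
    by (intro sum.cong refl) (simp add: u)
  also have "\<dots> = Q v s"
    using assms(3) B by simp
  finally show ?thesis ..
qed

text \<open>Multiply P y = q by \<open>Q\<close> from the left: the non-basic terms vanish at the
  basic solution, and \<open>Q\<close> times P_B is the identity.\<close>

lemma tableau_rhs_eq_basic_value:
  fixes H :: "bit^'n^'m"
  assumes "finite \<Lambda>" "basis_at H \<Lambda> x z B Q" "v \<in> B"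
  shows "tableau_rhs \<Lambda> Q v = lp_point x z v"
proof -
  let ?y = "lp_point x z"
  have inv: "basis_inverse H \<Lambda> B Q" and eq: "lp_equations H \<Lambda> ?y"
    and nb: "\<And>h. h \<in> lp_vars \<Lambda> - B \<Longrightarrow> ?y h = 0"
    using assms(2) by (auto simp: basis_at_def)
  have sub: "B \<subseteq> lp_vars \<Lambda>" and fin: "finite (lp_vars \<Lambda> :: ('n, 'm) lp_var set)"
    using inv finite_lp_vars[OF assms(1)] by (auto simp: basis_inverse_def)
  have "tableau_rhs \<Lambda> Q v = (\<Sum>r\<in>lp_rows \<Lambda>. Q v r * (\<Sum>w\<in>lp_vars \<Lambda>. lp_mat H r w * ?y w))"
    unfolding tableau_rhs_def using eq
    by (intro sum.cong refl) (simp add: lp_equations_def)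
  also have "\<dots> = (\<Sum>r\<in>lp_rows \<Lambda>. Q v r * (\<Sum>w\<in>B. lp_mat H r w * ?y w))"
    using sub fin nb
    by (intro sum.cong refl arg_cong2[where f="(*)"] sum.mono_neutral_right) auto
  also have "\<dots> = (\<Sum>w\<in>B. (\<Sum>r\<in>lp_rows \<Lambda>. Q v r * lp_mat H r w) * ?y w)"
    unfolding sum_distrib_left sum_distrib_right by (subst sum.swap) (simp add: mult.assoc)
  also have "\<dots> = (\<Sum>w\<in>B. if v = w then ?y w else 0)"
    using inv assms(3) by (intro sum.cong refl) (simp add: basis_inverse_def)
  also have "\<dots> = ?y v"
    using assms(3) finite_subset[OF sub fin] by simp
  finally show ?thesis .
qed

lemma basis_contains_nonzero:
  assumes "basis_at H \<Lambda> x z B Q" "v \<in> lp_vars \<Lambda>" "lp_point x z v \<noteq> 0"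
  shows "v \<in> B"
  using assms by (auto simp: basis_at_def)

text \<open>At the basic solution all non-basic variables are 0, so the left side of the cut is 0,
  while the right side is the positive fractional part of a non-integral value.\<close>

lemma gomory_cut_violated:
  fixes H :: "bit^'n^'m"
  assumes "finite \<Lambda>" "basis_at H \<Lambda> x z B Q" "v \<in> B" "lp_point x z v \<notin> \<int>"
  shows "\<not> gomory_cut H \<Lambda> B Q v (lp_point x z)"
proof -
  have "(\<Sum>h\<in>lp_vars \<Lambda> - B. (tableau H \<Lambda> Q v h - of_int \<lfloor>tableau H \<Lambda> Q v h\<rfloor>) * lp_point x z h) = 0"
    using assms(2) by (intro sum.neutral) (simp add: basis_at_def)
  moreover have "of_int \<lfloor>lp_point x z v\<rfloor> < lp_point x z v"
    using assms(4) by (metis Ints_of_int of_int_floor_le order_le_less)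
  ultimately show ?thesis
    unfolding gomory_cut_def tableau_rhs_eq_basic_value[OF assms(1-3)] by simp
qed

section \<open>The basis at a binary point\<close>

text \<open>Here \<open>T\<close> is the set of all \<open>j\<close> with \<open>x\<^sub>j = 1\<close>; the others have \<open>x\<^sub>j = 0\<close>.\<close>

definition bound_basis :: "('n::finite) cut set \<Rightarrow> 'n set \<Rightarrow> ('n, 'm) lp_var set" where
  "bound_basis \<Lambda> T = X ` T \<union> range Z \<union> Slack ` \<Lambda> \<union> Upper ` (- T)"

text \<open>Found by solving P_B y = r for an arbitrary r: the upper rows give x_j for j in
  \<open>T\<close> and the slacks of the other bounds; substituting these x_j into the check and cut
  rows gives z_i and the slacks of the cuts.\<close>

fun bound_inverse ::
  "bit^'n^'m \<Rightarrow> 'n set \<Rightarrow> ('n, 'm) lp_var \<Rightarrow> ('n, 'm) lp_row \<Rightarrow> real" where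
  "bound_inverse H T (Z i) (Check_row k) = (if k = i then - 1 / 2 else 0)"
| "bound_inverse H T (Z i) (Upper_row j) = (if j \<in> nbrs H i \<inter> T then 1 / 2 else 0)"
| "bound_inverse H T (X k) (Upper_row j) = (if j = k then 1 else 0)"
| "bound_inverse H T (Upper k) (Upper_row j) = (if j = k then 1 else 0)"
| "bound_inverse H T (Slack p) (Cut_row p') = (if p' = p then 1 else 0)"
| "bound_inverse H T (Slack p) (Upper_row j) = (if j \<in> T then - fst p $ j else 0)"
| "bound_inverse H T _ _ = 0"

lemma bound_basis_iff [simp]:
  "X j \<in> bound_basis \<Lambda> T \<longleftrightarrow> j \<in> T"
  "Z i \<in> bound_basis \<Lambda> T"
  "Slack p \<in> bound_basis \<Lambda> T \<longleftrightarrow> p \<in> \<Lambda>"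
  "Upper j \<in> bound_basis \<Lambda> T \<longleftrightarrow> j \<notin> T"
  by (auto simp: bound_basis_def)

lemma bound_basis_subset: "bound_basis \<Lambda> T \<subseteq> lp_vars \<Lambda>"
  by (auto simp: bound_basis_def lp_vars_def)

lemma bound_inverse_col:
  fixes H :: "bit^'n^'m"
  assumes "finite \<Lambda>" "v \<in> bound_basis \<Lambda> T" "w \<in> bound_basis \<Lambda> T"
  shows "(\<Sum>r\<in>lp_rows \<Lambda>. bound_inverse H T v r * lp_mat H r w) = (if v = w then 1 else 0)"
proof -
  have v: "v \<in> lp_vars \<Lambda>" and w: "w \<in> lp_vars \<Lambda>"
    using assms(2,3) bound_basis_subset by auto
  show ?thesis
  proof (cases rule: lp_vars_cases[OF w])
    case (1 j)
    \<comment> \<open>For a basic \<open>X j\<close>, so with \<open>j\<close> in \<open>T\<close>,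
      the term of \<open>Upper_row j\<close> cancels the check-row part if \<open>v\<close> is some
      \<open>Z i\<close>, and the cut-row part if \<open>v\<close> is a
      \<open>Slack\<close>.\<close>
    have check: "(\<Sum>k\<in>UNIV. if j \<in> nbrs H k then bound_inverse H T v (Check_row k) else 0)
        = (case v of Z i \<Rightarrow> if j \<in> nbrs H i then - 1 / 2 else 0 | _ \<Rightarrow> 0)"
      by (cases v) (simp_all add: sum_if_delta cong: if_cong)
    have cut: "(\<Sum>p\<in>\<Lambda>. bound_inverse H T v (Cut_row p) * fst p $ j)
        = (case v of Slack p \<Rightarrow> fst p $ j | _ \<Rightarrow> 0)"
      using assms(1,2)
      by (cases v) (simp_all add: if_distrib[of "\<lambda>a. a * _"] cong: if_cong)
    show ?thesis
      unfolding 1 lp_col_X[OF assms(1)] check cut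
      using assms(2,3) 1 by (cases rule: lp_vars_cases[OF v]) auto
  qed (use assms in \<open>cases rule: lp_vars_cases[OF v];
      force simp: lp_col_Z lp_col_Slack lp_col_Upper\<close>)+
qed

lemma sum_bound_basis:
  fixes f :: "('n::finite, 'm::finite) lp_var \<Rightarrow> real"
  assumes "finite \<Lambda>"
  shows "(\<Sum>v\<in>bound_basis \<Lambda> T. f v) =
    (\<Sum>j\<in>T. f (X j)) + (\<Sum>i\<in>UNIV. f (Z i)) + (\<Sum>p\<in>\<Lambda>. f (Slack p)) + (\<Sum>j\<in>-T. f (Upper j))"
proof -
  have "(\<Sum>v\<in>bound_basis \<Lambda> T. f v) =
    sum f (X ` T) + sum f (range Z) + sum f (Slack ` \<Lambda>) + sum f (Upper ` (- T))"
    unfolding bound_basis_def using assms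
    by (subst sum.union_disjoint; (auto)[1])+
  then show ?thesis
    by (simp add: sum.reindex inj_on_def)
qed

lemma bound_inverse_row:
  fixes H :: "bit^'n^'m"
  assumes "finite \<Lambda>" "r \<in> lp_rows \<Lambda>" "s \<in> lp_rows \<Lambda>"
  shows "(\<Sum>v\<in>bound_basis \<Lambda> T. lp_mat H r v * bound_inverse H T v s) = (if r = s then 1 else 0)"
proof -
  \<comment> \<open>Extension by zero to all variables makes the row formulas for P y
    applicable.\<close>
  have "(\<Sum>v\<in>bound_basis \<Lambda> T. lp_mat H r v * bound_inverse H T v s) =
    (\<Sum>v\<in>lp_vars \<Lambda>. lp_mat H r v * (if v \<in> bound_basis \<Lambda> T then bound_inverse H T v s else 0))"
    using finite_lp_vars[OF assms(1)] bound_basis_subset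
    by (intro sum.mono_neutral_cong_left) auto
  also have "\<dots> = (if r = s then 1 else 0)"
  proof (cases rule: lp_rows_cases[OF assms(2)])
    case (1 i)
    \<comment> \<open>Off the diagonal the \<open>X\<close> terms must cancel the \<open>Z i\<close>
      term, whose coefficient is -2; on the diagonal they vanish and -2 times -1/2 gives 1.\<close>
    have "(\<Sum>j\<in>nbrs H i. if j \<in> T then bound_inverse H T (X j) s else 0)
        = - (if r = s then 0 else - 2 * bound_inverse H T (Z i) s)"
    proof (cases rule: lp_rows_cases[OF assms(3)])
      case (3 k)
      then have "(\<Sum>j\<in>nbrs H i. if j \<in> T then bound_inverse H T (X j) s else 0)
          = (\<Sum>j\<in>nbrs H i. if k = j then if k \<in> T then 1 else 0 else 0)"
        by (intro sum.cong) auto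
      then show ?thesis
        using 1 3 by simp
    qed (auto simp: 1 cong: if_cong)
    moreover have "bound_inverse H T (Z i) s = - 1 / 2" if "r = s"
      using 1 that by auto
    ultimately show ?thesis
      by (simp add: 1 lp_row_Check assms(1))
  next
    case (2 p)
    show ?thesis
    proof (cases rule: lp_rows_cases[OF assms(3)])
      case (3 k)
      have "(\<Sum>j\<in>UNIV. fst p $ j * (if j \<in> T then bound_inverse H T (X j) s else 0))
          = (\<Sum>j\<in>UNIV. if k = j then if k \<in> T then fst p $ k else 0 else 0)"
        using 3 by (intro sum.cong) auto
      then show ?thesis
        using 2 3 by (simp add: lp_row_Cut assms(1))
    qed (auto simp: 2 lp_row_Cut assms(1) cong: if_cong)
  next
    case (3 j)
    show ?thesis
      by (cases rule: lp_rows_cases[OF assms(3)]) (auto simp: 3 lp_row_Upper assms(1))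
  qed
  finally show ?thesis .
qed

lemma bound_basis_inverse:
  fixes H :: "bit^'n^'m"
  assumes "finite \<Lambda>"
  shows "basis_inverse H \<Lambda> (bound_basis \<Lambda> T) (bound_inverse H T)"
  unfolding basis_inverse_def
  using bound_basis_subset bound_inverse_col[OF assms] bound_inverse_row[OF assms] by blast

text \<open>The non-basic variables are \<open>X j\<close> with x_j = 0 and \<open>Upper j\<close>
  with x_j = 1, so all of them vanish.\<close>

lemma bound_basis_at:
  fixes H :: "bit^'n^'m"
  assumes "finite \<Lambda>" "RIPD_feasible H \<Lambda> x z" "\<And>j. x $ j = (if j \<in> T then 1 else 0)"
  shows "basis_at H \<Lambda> x z (bound_basis \<Lambda> T) (bound_inverse H T)"
  unfolding basis_at_def
  by (auto intro!: bound_basis_inverse lp_equations_lp_point assms(1,2)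
      elim!: lp_vars_cases simp: assms(3))

section \<open>Reduced costs\<close>

text \<open>Finitely many strict inequalities survive a small shift by continuity, and z imposes no
  further restriction because it can follow x.\<close>

lemma eventually_feasible_coordinate_shift:
  fixes H :: "bit^'n^'m"
  assumes "finite \<Lambda>" "RIPD_feasible H \<Lambda> x z" "\<forall>p\<in>\<Lambda>. fst p \<bullet> x < snd p"
    and "\<forall>\<^sub>F e in at_right 0. 0 \<le> x $ j + e * d \<and> x $ j + e * d \<le> 1"
  shows "\<forall>\<^sub>F e in at_right 0. \<exists>z'. RIPD_feasible H \<Lambda> (x + (e * d) *\<^sub>R axis j 1) z'"
proof -
  let ?x = "\<lambda>e. x + (e * d) *\<^sub>R axis j (1::real)"
  have "\<forall>\<^sub>F e in at_right 0. fst p \<bullet> ?x e < snd p" if "p \<in> \<Lambda>" for p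
  proof (rule order_tendstoD(2))
    have "((\<lambda>e. fst p \<bullet> ?x e) \<longlongrightarrow> fst p \<bullet> ?x 0) (at_right 0)"
      by (intro tendsto_intros)
    then show "((\<lambda>e. fst p \<bullet> ?x e) \<longlongrightarrow> fst p \<bullet> x) (at_right 0)"
      by simp
  qed (use assms(3) that in auto)
  then have "\<forall>\<^sub>F e in at_right 0. \<forall>p\<in>\<Lambda>. fst p \<bullet> ?x e < snd p"
    using assms(1) by (simp add: eventually_ball_finite)
  with assms(4) show ?thesis
  proof eventually_elim
    case (elim e)
    have box: "0 \<le> ?x e $ k \<and> ?x e $ k \<le> 1" for k
      using elim(1) assms(2) by (cases "k = j") (auto simp: axis_def RIPD_feasible_def)
    \<comment> \<open>The equation forces z to be half of \<open>H\<close> x, which is nonnegative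
      since x is.\<close>
    have "RIPD_feasible H \<Lambda> (?x e) ((1/2) *\<^sub>R (real_mat H *v ?x e))"
      unfolding RIPD_feasible_def
    proof (intro conjI allI ballI)
      fix i
      show "0 \<le> ((1/2) *\<^sub>R (real_mat H *v ?x e)) $ i"
        using box by (simp add: real_mat_vec sum_nonneg del: vector_add_component)
    qed (use elim(2) box in \<open>auto intro: less_imp_le\<close>)
    then show ?case ..
  qed
qed

text \<open>A feasible shift by \<open>e * d\<close> changes the cost by
  \<open>e * d * c $ j\<close>, which optimality makes nonnegative.\<close>

lemma optimal_cost_direction:
  fixes H :: "bit^'n^'m"
  assumes "finite \<Lambda>" "RIPD_optimal H c \<Lambda> x z" "\<forall>p\<in>\<Lambda>. fst p \<bullet> x < snd p"
    and "\<forall>\<^sub>F e in at_right 0. 0 \<le> x $ j + e * d \<and> x $ j + e * d \<le> 1"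
  shows "0 \<le> d * c $ j"
proof -
  have feas: "RIPD_feasible H \<Lambda> x z"
    using assms(2) by (simp add: RIPD_optimal_def)
  have "\<forall>\<^sub>F e in at_right (0::real). e > 0"
    by (simp add: eventually_at_right_less)
  with eventually_feasible_coordinate_shift[OF assms(1) feas assms(3,4)]
  have "\<forall>\<^sub>F e in at_right (0::real). e > 0 \<and> (\<exists>z'. RIPD_feasible H \<Lambda> (x + (e * d) *\<^sub>R axis j 1) z')"
    by eventually_elim auto
  then obtain e z' where e: "e > 0" "RIPD_feasible H \<Lambda> (x + (e * d) *\<^sub>R axis j 1) z'"
    using eventually_happens'[OF trivial_limit_at_right_real] by blast
  then have "c \<bullet> x \<le> c \<bullet> (x + (e * d) *\<^sub>R axis j 1)"
    using assms(2) by (auto simp: RIPD_optimal_def)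
  then have "0 \<le> e * (d * c $ j)"
    by (simp add: inner_add_right inner_axis mult.assoc)
  with e(1) show ?thesis
    by (simp add: zero_le_mult_iff)
qed

text \<open>The reduced cost is c_j at \<open>X j\<close> for j outside \<open>T\<close>, and -c_j
  at \<open>Upper j\<close> for j in \<open>T\<close>. Moving x_j inwards from its bound shows that
  both are nonnegative.\<close>

lemma bound_basis_reduced_costs:
  fixes H :: "bit^'n^'m"
  assumes "finite \<Lambda>" "RIPD_optimal H c \<Lambda> x z" "\<forall>p\<in>\<Lambda>. fst p \<bullet> x < snd p"
    and bin: "\<And>j. x $ j = (if j \<in> T then 1 else 0)"
  shows "nonneg_reduced_costs H c \<Lambda> (bound_basis \<Lambda> T) (bound_inverse H T)"
proof -
  have small: "\<forall>\<^sub>F e in at_right (0::real). 0 < e \<and> e < 1"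
    using eventually_at_right_real[of 0 "1::real"] by simp
  have nonneg: "0 \<le> c $ j" if "j \<notin> T" for j
  proof -
    have "\<forall>\<^sub>F e in at_right 0. 0 \<le> x $ j + e * 1 \<and> x $ j + e * 1 \<le> 1"
      using small by eventually_elim (use that in \<open>simp add: bin\<close>)
    from optimal_cost_direction[OF assms(1-3) this] show ?thesis by simp
  qed
  have nonpos: "c $ j \<le> 0" if "j \<in> T" for j
  proof -
    have "\<forall>\<^sub>F e in at_right 0. 0 \<le> x $ j + e * (-1) \<and> x $ j + e * (-1) \<le> 1"
      using small by eventually_elim (use that in \<open>simp add: bin\<close>)
    from optimal_cost_direction[OF assms(1-3) this] show ?thesis by simp
  qed
  have "(\<Sum>v\<in>bound_basis \<Lambda> T. lp_cost c v * tableau H \<Lambda> (bound_inverse H T) v h)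
      = (\<Sum>j\<in>T. c $ j * tableau H \<Lambda> (bound_inverse H T) (X j) h)" for h
    by (simp add: sum_bound_basis assms(1))
  then show ?thesis
    unfolding nonneg_reduced_costs_def
    by (auto elim!: lp_vars_cases intro!: nonneg
        simp: tableau_def lp_col_X lp_col_Upper assms(1) nonpos
          if_distrib[of "\<lambda>a. _ * a"] cong: if_cong)
qed

section \<open>The Gomory cut\<close>

text \<open>Outside N_i the basis may differ from \<open>bound_basis\<close>, but the row of z_i is
  the same. The cut involves slacks, so it is compared with an inequality in x on the solutions of P
  y = q.\<close>

lemma gomory_cut_Z_iff_forbidden_set_ineq:
  fixes H :: "bit^'n^'m"
  assumes fin: "finite \<Lambda>"
    and at: "basis_at H \<Lambda> x z B Q" and ZB: "Z i \<in> B" and nb: "nonbasic_at_bounds H i B"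
    and bin: "\<And>j. x $ j = (if j \<in> T then 1 else 0)"
    and frac: "z $ i - of_int \<lfloor>z $ i\<rfloor> = 1 / 2"
    and y: "lp_equations H \<Lambda> y"
  shows "gomory_cut H \<Lambda> B Q (Z i) y \<longleftrightarrow> forbidden_set_ineq H i (nbrs H i \<inter> T) (x_part y)"
proof -
  let ?N = "nbrs H i" and ?S = "nbrs H i \<inter> T" and ?t = "tableau H \<Lambda> Q (Z i)"
  have inv: "basis_inverse H \<Lambda> B Q" and sub: "B \<subseteq> lp_vars \<Lambda>"
    using at by (auto simp: basis_at_def basis_inverse_def)
  have XB: "X j \<in> B" if "j \<in> T" for j
    using basis_contains_nonzero[OF at] that by (simp add: bin lp_vars_def)
  have UB: "Upper j \<in> B" if "j \<notin> T" for j
    using basis_contains_nonzero[OF at] that by (simp add: bin lp_vars_def)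
  \<comment> \<open>Nonzero values force one of \<open>X j\<close>, \<open>Upper j\<close> into the
    basis, and \<open>nb\<close> keeps the other one out.\<close>
  have bound: "X j \<in> B \<longleftrightarrow> j \<in> T" "Upper j \<in> B \<longleftrightarrow> j \<notin> T" if "j \<in> ?N" for j
    using nb that XB UB by (auto simp: nonbasic_at_bounds_def)
  have col: "(\<Sum>r\<in>lp_rows \<Lambda>. bound_inverse H T (Z i) r * lp_mat H r w)
      = (case w of X j \<Rightarrow> if j \<in> ?N - T then - 1 / 2 else 0
         | Z k \<Rightarrow> if k = i then 1 else 0 | Slack p \<Rightarrow> 0 | Upper j \<Rightarrow> if j \<in> ?S then 1 / 2 else 0)"
    if "w \<in> lp_vars \<Lambda>" for w
    using that by (cases rule: lp_vars_cases)
      (auto simp: lp_col_X lp_col_Z lp_col_Slack lp_col_Upper fin sum_if_delta cong: if_cong)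
  have "Q (Z i) r = bound_inverse H T (Z i) r" if "r \<in> lp_rows \<Lambda>" for r
  proof (rule basis_inverse_row_unique[OF fin inv ZB that])
    \<comment> \<open>A nonzero entry at \<open>X j\<close> or \<open>Upper j\<close> requires j in
      N_i and value 0 of that variable, and by \<open>bound\<close> such a variable is
      non-basic.\<close>
    fix w assume "w \<in> B"
    with sub bound show "(\<Sum>r\<in>lp_rows \<Lambda>. bound_inverse H T (Z i) r * lp_mat H r w)
        = (if Z i = w then 1 else 0)"
      by (subst col) (auto split: lp_var.split)
  qed
  then have t: "?t w = (case w of X j \<Rightarrow> if j \<in> ?N - T then - 1 / 2 else 0
         | Z k \<Rightarrow> if k = i then 1 else 0 | Slack p \<Rightarrow> 0 | Upper j \<Rightarrow> if j \<in> ?S then 1 / 2 else 0)"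
    if "w \<in> lp_vars \<Lambda>" for w
    unfolding tableau_def col[OF that, symmetric] by simp
  \<comment> \<open>Both -1/2 and 1/2 have fractional part 1/2, so \<open>X j\<close> and
    \<open>Upper j\<close> enter the cut with the same coefficient.\<close>
  have halves: "\<lfloor>- 1 / 2 :: real\<rfloor> = - 1" "\<lfloor>1 / 2 :: real\<rfloor> = 0"
    by linarith+
  let ?f = "\<lambda>w. ?t w - of_int \<lfloor>?t w\<rfloor>"
  have f: "?f w = (case w of X j \<Rightarrow> if j \<in> ?N - T then 1 / 2 else 0
         | Upper j \<Rightarrow> if j \<in> ?S then 1 / 2 else 0 | _ \<Rightarrow> 0)" if "w \<in> lp_vars \<Lambda>" for w
    unfolding t[OF that] using halves by (auto split: lp_var.split)
  \<comment> \<open>Basic variables have tableau entry 0 or 1, hence fractional part 0, and may be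
    added to the sum.\<close>
  have "(\<Sum>h\<in>lp_vars \<Lambda> - B. ?f h * y h) = (\<Sum>h\<in>lp_vars \<Lambda>. ?f h * y h)"
  proof (rule sum.mono_neutral_left)
    show "\<forall>h\<in>lp_vars \<Lambda> - (lp_vars \<Lambda> - B). ?f h * y h = 0"
      using bound by (auto simp: f split: lp_var.split)
  qed (use finite_lp_vars[OF fin] in auto)
  also have "\<dots> = (\<Sum>h\<in>lp_vars \<Lambda>. (case h of X j \<Rightarrow> if j \<in> ?N - T then 1 / 2 else 0
         | Upper j \<Rightarrow> if j \<in> ?S then 1 / 2 else 0 | _ \<Rightarrow> 0) * y h)"
    by (intro sum.cong refl) (simp only: f)
  also have "\<dots> = (\<Sum>j\<in>?N - T. y (X j) / 2) + (\<Sum>j\<in>?S. y (Upper j) / 2)"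
  proof -
    have "(\<Sum>j\<in>UNIV. (if j \<in> A then 1 / 2 else 0) * g j) = (\<Sum>j\<in>A. g j / 2)"
      for A :: "'n set" and g :: "'n \<Rightarrow> real"
      by (intro sum.mono_neutral_cong_right) auto
    then show ?thesis
      unfolding sum_lp_vars[OF fin] by (simp del: Diff_iff Int_iff)
  qed
  also have "(\<Sum>j\<in>?S. y (Upper j) / 2) = (\<Sum>j\<in>?S. (1 - y (X j)) / 2)"
  proof (intro sum.cong refl)
    fix j
    have "y (X j) + y (Upper j) = lp_rhs (Upper_row j :: ('n, 'm) lp_row)"
      unfolding lp_row_Upper[OF fin, of H, symmetric]
      using y by (simp add: lp_equations_def lp_rows_def)
    then show "y (Upper j) / 2 = (1 - y (X j)) / 2"
      by simp
  qed
  finally have lhs: "(\<Sum>h\<in>lp_vars \<Lambda> - B. ?f h * y h)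
      = ((\<Sum>j\<in>?N - T. y (X j)) + (real (card ?S) - (\<Sum>j\<in>?S. y (X j)))) / 2"
    by (simp add: sum_divide_distrib[symmetric] sum_subtractf add_divide_distrib)
  \<comment> \<open>Both sides of the cut are now halves; doubling and rearranging gives the
    Forbidden Set Inequality.\<close>
  have "?N - ?S = ?N - T"
    by auto
  then show ?thesis
    unfolding gomory_cut_def forbidden_set_ineq_def lhs
      tableau_rhs_eq_basic_value[OF fin at ZB] lp_point.simps frac
    by (auto simp: x_part_def)
qed

text \<open>The final existence claim shows that the condition \<open>nonbasic_at_bounds\<close> can
  always be met by a basis at the given point.\<close>

theorem mainTheorem1:
  fixes H :: "bit^'n^'m" and c :: "real^'n" and \<Lambda> :: "'n cut set"
    and xs :: "real^'n" and zs :: "real^'m" and i :: 'm and S :: "'n set"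
  assumes "finite \<Lambda>"
    and "\<forall>p\<in>\<Lambda>. valid_cut H p"
    and "RIPD_optimal H c \<Lambda> xs zs"
    and "\<forall>j. xs $ j \<in> \<int>"
    and "zs $ i \<notin> \<int>"
    and "S = {j \<in> nbrs H i. xs $ j = 1}"
  shows "forbidden_set H i S
    \<and> (\<forall>B Q. basis_at H \<Lambda> xs zs B Q \<longrightarrow>
          Z i \<in> B
        \<and> \<not> gomory_cut H \<Lambda> B Q (Z i) (lp_point xs zs)
        \<and> (nonbasic_at_bounds H i B \<longrightarrow>
             (\<forall>y. lp_equations H \<Lambda> y \<longrightarrow>
                (gomory_cut H \<Lambda> B Q (Z i) y \<longleftrightarrow> forbidden_set_ineq H i S (x_part y)))))
    \<and> (\<exists>B Q. basis_at H \<Lambda> xs zs B Q \<and> nonbasic_at_bounds H i B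
        \<and> ((\<forall>p\<in>\<Lambda>. fst p \<bullet> xs < snd p) \<longrightarrow> nonneg_reduced_costs H c \<Lambda> B Q))"
proof -
  define T where "T = {j. xs $ j = 1}"
  have S: "S = nbrs H i \<inter> T"
    by (auto simp: assms(6) T_def)
  have feas: "RIPD_feasible H \<Lambda> xs zs"
    using assms(3) by (simp add: RIPD_optimal_def)
  have bin: "xs $ j = (if j \<in> T then 1 else 0)" for j
  proof -
    obtain k where "xs $ j = of_int k"
      using assms(4) Ints_cases by blast
    moreover have "0 \<le> xs $ j" "xs $ j \<le> 1"
      using feas by (auto simp: RIPD_feasible_def)
    ultimately show ?thesis
      by (cases "k = 0") (auto simp: T_def)
  qed
  have "(real_mat H *v xs - 2 *\<^sub>R zs) $ i = 0"
    using feas by (simp add: RIPD_feasible_def)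
  \<comment> \<open>At a binary point row i of \<open>H\<close> x counts the ones in N_i, so z_i is
    half of \<open>card S\<close>; being non-integral, it is an integer plus 1/2.\<close>
  then have z: "2 * zs $ i = real (card S)"
    by (simp add: real_mat_vec bin sum.If_cases S)
  have "odd (card S)"
  proof
    assume "even (card S)"
    then obtain k where "card S = 2 * k" by blast
    with z have "zs $ i = of_nat k" by simp
    with assms(5) show False by simp
  qed
  then obtain k where "card S = 2 * k + 1"
    by (rule oddE)
  with z have zk: "zs $ i = of_int (int k) + 1 / 2"
    by simp
  then have "\<lfloor>zs $ i\<rfloor> = int k"
    by (simp add: floor_eq_iff)
  with zk have frac: "zs $ i - of_int \<lfloor>zs $ i\<rfloor> = 1 / 2"
    by simp
  have "forbidden_set H i S"
    using \<open>odd (card S)\<close> by (simp add: forbidden_set_def S)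
  moreover have "Z i \<in> B \<and> \<not> gomory_cut H \<Lambda> B Q (Z i) (lp_point xs zs)
      \<and> (nonbasic_at_bounds H i B \<longrightarrow> (\<forall>y. lp_equations H \<Lambda> y \<longrightarrow>
           (gomory_cut H \<Lambda> B Q (Z i) y \<longleftrightarrow> forbidden_set_ineq H i S (x_part y))))"
    if at: "basis_at H \<Lambda> xs zs B Q" for B Q
  proof -
    \<comment> \<open>A non-integral value is nonzero, so z_i is basic in every basis at this
      point.\<close>
    have ZB: "Z i \<in> B"
      using assms(5) by (intro basis_contains_nonzero[OF at]) (auto simp: lp_vars_def)
    then show ?thesis
      using gomory_cut_violated[OF assms(1) at ZB] assms(5)
        gomory_cut_Z_iff_forbidden_set_ineq[OF assms(1) at ZB _ bin frac]
      by (simp add: S)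
  qed
  moreover have "nonbasic_at_bounds H i (bound_basis \<Lambda> T)"
    by (simp add: nonbasic_at_bounds_def)
  ultimately show ?thesis
    using bound_basis_at[OF assms(1) feas bin] bound_basis_reduced_costs[OF assms(1,3) _ bin]
    by blast
qed

end
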